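(* Let $G$ be an abelian group, let $q\in\mathbb N$, let $\mathcal A=(A_1,\dots,A_q)$ be a $q$-tuple of nonempty subsets of $G$, and fix $r\in\mathbb N$. Assume that for each $i\in\{1,\dots,q\}$ the set $A_i$ is an asymptotic $(r,\ell_i)$-approximate group, where $\ell_i\in\mathbb N$. Then $\mathcal A$ is a chromatic asymptotic $\bigl(r,\prod_{i=1}^q \ell_i\bigr)$-approximate group.
   Context: $\mathbb N=\{1,2,\dots\}$, $\mathbb N_0=\{0,1,2,\dots\}$. For subsets $X,Y$ of an abelian group, $X+Y=\{x+y:x\in X,y\in Y\}$; for $h\in\mathbb N$, $hA=A+\cdots+A$ ($h$ summands) and $0A=\{0\}$. A nonempty set $A\subseteq G$ is an asymptotic $(r,\ell)$-approximate group if there is $h_0\in\mathbb N$ such that for every integer $h\ge h_0$ there is $X_h\subseteq G$ with $|X_h|\le\ell$ and $r(hA)\subseteq X_h+hA$. For $\mathbf h=(h_1,\dots,h_q)\in\mathbb N_0^q$ the chromatic sumset is $\mathbf h\cdot\mathcal A=h_1A_1+\cdots+h_qA_q$; $r\mathbf h=(rh_1,\dots,rh_q)$; $\mathbf h\preceq\mathbf h'$ means $h_i\le h_i'$ for all $i$. A tuple $\mathcal A$ of nonempty subsets of $G$ is a chromatic asymptotic $(r,\ell)$-approximate group if there is $\mathbf h_0\in\mathbb N_0^q$ such that for every $\mathbf h\succeq\mathbf h_0$ there is $X_{\mathbf h}\subseteq G$ with $|X_{\mathbf h}|\le\ell$ and $(r\mathbf h)\cdot\mathcal A\subseteq X_{\mathbf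 h}+\mathbf h\cdot\mathcal A$. *)

theory Defs
  imports Main "HOL-Library.Set_Algebras"
begin

text \<open>
  Sumsets \<open>X + Y\<close> are the elementwise sums of \<open>HOL-Library.Set_Algebras\<close>, which make
  \<open>'a set\<close> a commutative monoid with \<open>0 = {0}\<close>; in particular an empty sum of sets is \<open>{0}\<close>.
\<close>

definition sumset :: "nat \<Rightarrow> 'a::ab_group_add set \<Rightarrow> 'a set" where
  "sumset h A = (\<Sum>j\<in>{1..h}. A)"

text \<open>
  In \<open>asymptotic_approx_group\<close>, \<open>r(hA)\<close> is the \<open>r\<close>-fold sumset of \<open>hA\<close>.
  The condition \<open>finite X\<close> is explicit because \<open>card\<close> of an infinite set is 0.
\<close>

definition asymptotic_approx_group :: "nat \<Rightarrow> nat \<Rightarrow> 'a::ab_group_add set \<Rightarrow> bool" where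
  "asymptotic_approx_group r l A \<longleftrightarrow>
     A \<noteq> {} \<and>
     (\<exists>h0\<ge>1. \<forall>h\<ge>h0. \<exists>X. finite X \<and> card X \<le> l \<and>
        sumset r (sumset h A) \<subseteq> X + sumset h A)"

text \<open>
  A \<open>q\<close>-tuple is a function on \<open>nat\<close>, of which only the values at \<open>{1..q}\<close> are used.
\<close>

definition chromatic_sumset :: "nat \<Rightarrow> (nat \<Rightarrow> nat) \<Rightarrow> (nat \<Rightarrow> 'a::ab_group_add set) \<Rightarrow> 'a set" where
  "chromatic_sumset q h A = (\<Sum>i\<in>{1..q}. sumset (h i) (A i))"

definition chromatic_asymptotic_approx_group ::
    "nat \<Rightarrow> nat \<Rightarrow> nat \<Rightarrow> (nat \<Rightarrow> 'a::ab_group_add set) \<Rightarrow> bool" where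
  "chromatic_asymptotic_approx_group q r l A \<longleftrightarrow>
     (\<forall>i\<in>{1..q}. A i \<noteq> {}) \<and>
     (\<exists>h0. \<forall>h. (\<forall>i\<in>{1..q}. h0 i \<le> h i) \<longrightarrow>
        (\<exists>X. finite X \<and> card X \<le> l \<and>
           chromatic_sumset q (\<lambda>i. r * h i) A \<subseteq> X + chromatic_sumset q h A))"

end

theory Submission
  imports Defs
begin

text \<open>Since \<open>r(hA) = (rh)A\<close>, each hypothesis says that \<open>(r h_i)A_i\<close>
  is covered by at most \<open>l i\<close> translates of \<open>h_i A_i\<close> once
  \<open>h_i\<close> is large. Adding these inclusions over \<open>i\<close> and regrouping by
  commutativity gives a cover of the chromatic sumset by translates along the sum of the sets
  \<open>X_i\<close>. That sum has at most as many elements as there are tuples in the product of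
  the \<open>X_i\<close>, hence at most the product of the \<open>l i\<close>
  (\<open>finite_sum_sets_card_le\<close>). The inclusions add up by
  \<open>sum_sets_mono\<close>.\<close>

lemma sumset_0 [simp]: "sumset 0 A = 0"
  by (simp add: sumset_def)

lemma sumset_Suc [simp]: "sumset (Suc h) A = sumset h A + A"
  by (simp add: sumset_def add.commute)

lemma sumset_add: "sumset (m + n) A = sumset m A + sumset n A"
  by (induction n) (simp_all add: add.assoc)

text \<open>Bridges the two definitions: the single-set notion iterates the sumset, while the
  chromatic one multiplies the exponents by \<open>r\<close>.\<close>

lemma sumset_sumset: "sumset r (sumset h A) = sumset (r * h) A"
  by (induction r) (simp_all add: sumset_add add.commute)

lemma card_set_plus_le:
  assumes "finite X" "finite Y"
  shows "card (X + Y) \<le> card X * card Y"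
  unfolding set_plus_image card_cartesian_product[symmetric]
  using assms by (intro card_image_le) simp

text \<open>Induction on \<open>I\<close>, adding one set at a time. Finiteness is proved along with
  the bound because \<open>card_set_plus_le\<close> requires it of the partial sum. The empty sum is
  \<open>{0}\<close>, matching the empty product 1.\<close>

lemma finite_sum_sets_card_le:
  fixes X :: "'i \<Rightarrow> 'a::ab_group_add set"
  assumes "finite I" "\<And>i. i \<in> I \<Longrightarrow> finite (X i)"
  shows "finite (\<Sum>i\<in>I. X i) \<and> card (\<Sum>i\<in>I. X i) \<le> (\<Prod>i\<in>I. card (X i))"
  using assms
proof (induction I rule: finite_induct)
  case empty
  then show ?case by (simp add: set_zero)
next
  case (insert i I)
  then have "card (X i + (\<Sum>i\<in>I. X i)) \<le> card (X i) * card (\<Sum>i\<in>I. X i)"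
    by (intro card_set_plus_le) auto
  also have "\<dots> \<le> card (X i) * (\<Prod>i\<in>I. card (X i))"
    using insert by (intro mult_left_mono) auto
  finally show ?case using insert by (simp add: finite_set_plus)
qed

lemma sum_sets_mono:
  fixes S T :: "'i \<Rightarrow> 'a::ab_group_add set"
  assumes "\<And>i. i \<in> I \<Longrightarrow> S i \<subseteq> T i"
  shows "(\<Sum>i\<in>I. S i) \<subseteq> (\<Sum>i\<in>I. T i)"
  using assms by (induction I rule: infinite_finite_induct) (simp_all add: set_plus_mono2)

theorem theorem1p11:
  fixes A :: "nat \<Rightarrow> 'a::ab_group_add set"
    and q r :: nat
    and l :: "nat \<Rightarrow> nat"
  assumes "q \<ge> 1"
    and "r \<ge> 1"
    and "\<And>i. i \<in> {1..q} \<Longrightarrow> A i \<noteq> {}"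
    and "\<And>i. i \<in> {1..q} \<Longrightarrow> l i \<ge> 1"
    and "\<And>i. i \<in> {1..q} \<Longrightarrow> asymptotic_approx_group r (l i) (A i)"
  shows "chromatic_asymptotic_approx_group q r (\<Prod>i\<in>{1..q}. l i) A"
proof -
  have "\<forall>i\<in>{1..q}. \<exists>h0. \<forall>h\<ge>h0. \<exists>X. finite X \<and> card X \<le> l i \<and>
      sumset (r * h) (A i) \<subseteq> X + sumset h (A i)"
    using assms(5) unfolding asymptotic_approx_group_def sumset_sumset by blast
  \<comment> \<open>Choosing a threshold for each index yields the threshold vector of the chromatic
    definition.\<close>
  then obtain h0 where h0: "\<And>i h. \<lbrakk>i \<in> {1..q}; h0 i \<le> h\<rbrakk> \<Longrightarrow> \<exists>X. finite X \<and> card X \<le> l i \<and>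
      sumset (r * h) (A i) \<subseteq> X + sumset h (A i)"
    by metis
  have "\<exists>X. finite X \<and> card X \<le> (\<Prod>i\<in>{1..q}. l i) \<and>
      chromatic_sumset q (\<lambda>i. r * h i) A \<subseteq> X + chromatic_sumset q h A"
    if h: "\<forall>i\<in>{1..q}. h0 i \<le> h i" for h
  proof -
    have "\<forall>i\<in>{1..q}. \<exists>X. finite X \<and> card X \<le> l i \<and>
        sumset (r * h i) (A i) \<subseteq> X + sumset (h i) (A i)"
      using h0 h by blast
    then obtain X where X: "\<And>i. i \<in> {1..q} \<Longrightarrow> finite (X i)"
        "\<And>i. i \<in> {1..q} \<Longrightarrow> card (X i) \<le> l i"
        "\<And>i. i \<in> {1..q} \<Longrightarrow> sumset (r * h i) (A i) \<subseteq> X i + sumset (h i) (A i)"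
      by metis
    have sum_X: "finite (\<Sum>i\<in>{1..q}. X i)"
        "card (\<Sum>i\<in>{1..q}. X i) \<le> (\<Prod>i\<in>{1..q}. card (X i))"
      using finite_sum_sets_card_le[of "{1..q}" X] X(1) by auto
    have "(\<Prod>i\<in>{1..q}. card (X i)) \<le> (\<Prod>i\<in>{1..q}. l i)"
      using X(2) by (intro prod_mono) auto
    \<comment> \<open>Sets form a commutative monoid under \<open>+\<close>, so
      \<open>sum.distrib\<close> read backwards merges the right-hand side into one sum of the sets
      \<open>X i + sumset (h i) (A i)\<close>; the inclusion can then be checked index by
      index.\<close>
    moreover have "chromatic_sumset q (\<lambda>i. r * h i) A
        \<subseteq> (\<Sum>i\<in>{1..q}. X i) + chromatic_sumset q h A"
      unfolding chromatic_sumset_def sum.distrib[symmetric] by (intro sum_sets_mono X(3))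
    ultimately show ?thesis using sum_X by (meson order_trans)
  qed
  then show ?thesis
    using assms(3) unfolding chromatic_asymptotic_approx_group_def by blast
qed

end
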